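(* Let $\mathcal{H}$ be a complex Hilbert space with identity operator $I$, let $m,M\in\mathbb{R}$, and let $A,B$ be invertible positive bounded operators on $\mathcal{H}$ with $0<mI\leq A\leq MI$ and $0<mI\leq B\leq MI$. Put $h=\frac{M}{m}$ and assume $h>1$. Then for every $\nu\in[0,1]$, with $r=\min\{\nu,1-\nu\}$, $$h\sqrt{M}\,L(\sqrt{M},\sqrt{m})\,\log S(\sqrt{h})\;\geq\;(1-\nu)A+\nu B-A\sharp_{\nu}B-2r\left(\frac{A+B}{2}-A\sharp_{1/2}B\right),$$ where the scalar on the left-hand side is understood as that multiple of the identity operator $I$.
   Context: A self-adjoint bounded operator $A$ on a complex Hilbert space $\mathcal{H}$ is called positive if $\langle x,Ax\rangle\geq 0$ for all $x\in\mathcal{H}$. For self-adjoint $A,B$, $A\geq B$ means that $A-B$ is positive; $0<mI$ means $m>0$. For invertible positive operators $A,B$ and $\nu\in[0,1]$, $A\sharp_{\nu}B := A^{1/2}\left(A^{-1/2}BA^{-1/2}\right)^{\nu}A^{1/2}$, with powers defined by the continuous functional calculus. Specht's ratio is defined for positive real $h\neq 1$ by $$S(h):=\frac{h^{\frac{1}{h-1}}}{e\log\left(h^{\frac{1}{h-1}}\right)}.$$ The logarithmic mean of positive reals $x,y$ is $L(x,y):=\frac{y-x}{\log y-\log x}$ for $x\neq y$, and $L(x,x):=x$. *)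

theory Defs
  imports "HOL-Analysis.Analysis" "HOL-Computational_Algebra.Polynomial"
begin

text \<open>
  Complex Hilbert spaces, as Banach spaces (over the reals) with a compatible complex scalar
  multiplication and a complex inner product inducing the norm. The inner product is
  conjugate-linear in the first and linear in the second argument.
\<close>

class chilbert_space = banach +
  fixes scaleC :: "complex \<Rightarrow> 'a \<Rightarrow> 'a" (infixr "*\<^sub>C" 75)
    and cinner :: "'a \<Rightarrow> 'a \<Rightarrow> complex"
  assumes scaleC_add_right: "a *\<^sub>C (x + y) = a *\<^sub>C x + a *\<^sub>C y"
    and scaleC_add_left: "(a + b) *\<^sub>C x = a *\<^sub>C x + b *\<^sub>C x"
    and scaleC_scaleC: "a *\<^sub>C (b *\<^sub>C x) = (a * b) *\<^sub>C x"
    and scaleC_one: "1 *\<^sub>C x = x"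
    and scaleR_scaleC: "t *\<^sub>R x = complex_of_real t *\<^sub>C x"
    and cinner_add_right: "cinner x (y + z) = cinner x y + cinner x z"
    and cinner_scaleC_right: "cinner x (a *\<^sub>C y) = a * cinner x y"
    and cinner_commute: "cinner x y = cnj (cinner y x)"
    and cinner_nonneg: "cinner x x \<in> \<real>\<^sub>\<ge>\<^sub>0"
    and norm_eq_sqrt_cinner: "norm x = sqrt (Re (cinner x x))"

lemma norm_scaleC: "norm (a *\<^sub>C x) = cmod a * norm (x :: 'a :: chilbert_space)"
proof -
  have "cinner (a *\<^sub>C x) (a *\<^sub>C x) = a * cnj a * cinner x x"
    by (metis cinner_commute cinner_scaleC_right complex_cnj_mult mult.assoc)
  also have "\<dots> = of_real ((cmod a)\<^sup>2) * cinner x x"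
    by (simp only: complex_norm_square)
  finally show ?thesis
    by (simp add: norm_eq_sqrt_cinner real_sqrt_mult)
qed

text \<open>
  The library type of bounded operators consists of real-linear ones; complex linearity is the
  separate predicate \<open>clinear_op\<close>.
\<close>

definition clinear_op :: "('a::chilbert_space \<Rightarrow>\<^sub>L 'a) \<Rightarrow> bool" where
  "clinear_op A \<longleftrightarrow> (\<forall>c x. blinfun_apply A (c *\<^sub>C x) = c *\<^sub>C blinfun_apply A x)"

lift_definition scalar_op :: "complex \<Rightarrow> 'a::chilbert_space \<Rightarrow>\<^sub>L 'a" is "\<lambda>c x. c *\<^sub>C x"
proof -
  fix c :: complex
  show "bounded_linear (\<lambda>x::'a. c *\<^sub>C x)"
    by (rule bounded_linear_intro[where K = "cmod c"])
      (simp_all add: scaleC_add_right scaleR_scaleC scaleC_scaleC norm_scaleC mult.commute)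
qed

definition selfadjoint_op :: "('a::chilbert_space \<Rightarrow>\<^sub>L 'a) \<Rightarrow> bool" where
  "selfadjoint_op A \<longleftrightarrow> clinear_op A \<and>
     (\<forall>x y. cinner x (blinfun_apply A y) = cinner (blinfun_apply A x) y)"

definition positive_op :: "('a::chilbert_space \<Rightarrow>\<^sub>L 'a) \<Rightarrow> bool" where
  "positive_op A \<longleftrightarrow> selfadjoint_op A \<and> (\<forall>x. cinner x (blinfun_apply A x) \<in> \<real>\<^sub>\<ge>\<^sub>0)"

definition op_ge :: "('a::chilbert_space \<Rightarrow>\<^sub>L 'a) \<Rightarrow> ('a \<Rightarrow>\<^sub>L 'a) \<Rightarrow> bool" (infix "\<succeq>" 50) where
  "A \<succeq> B \<longleftrightarrow> positive_op (A - B)"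

definition invertible_op :: "('a::chilbert_space \<Rightarrow>\<^sub>L 'a) \<Rightarrow> bool" where
  "invertible_op A \<longleftrightarrow>
     (\<exists>S. clinear_op S \<and> A o\<^sub>L S = id_blinfun \<and> S o\<^sub>L A = id_blinfun)"

definition spectrum_op :: "('a::chilbert_space \<Rightarrow>\<^sub>L 'a) \<Rightarrow> complex set" where
  "spectrum_op A = {z. \<not> invertible_op (A - scalar_op z)}"

definition poly_op :: "real poly \<Rightarrow> ('a::chilbert_space \<Rightarrow>\<^sub>L 'a) \<Rightarrow> ('a \<Rightarrow>\<^sub>L 'a)" where
  "poly_op p A = (\<Sum>i\<le>degree p. coeff p i *\<^sub>R (((o\<^sub>L) A) ^^ i) id_blinfun)"

text \<open>
  Continuous functional calculus for a self-adjoint operator \<open>A\<close> and a real function \<open>f\<close>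
  continuous on the (real) spectrum of \<open>A\<close>: the norm limit of \<open>p\<^sub>n(A)\<close> for any sequence of
  polynomials \<open>p\<^sub>n\<close> converging to \<open>f\<close> uniformly on the spectrum.
\<close>

definition cfc :: "(real \<Rightarrow> real) \<Rightarrow> ('a::chilbert_space \<Rightarrow>\<^sub>L 'a) \<Rightarrow> ('a \<Rightarrow>\<^sub>L 'a)" where
  "cfc f A = (THE T. \<exists>p :: nat \<Rightarrow> real poly.
     uniform_limit {t. complex_of_real t \<in> spectrum_op A} (\<lambda>n t. poly (p n) t) f sequentially \<and>
     (\<lambda>n. poly_op (p n) A) \<longlonglongrightarrow> T)"

text \<open>
  Real powers are only meant for invertible positive operators, where the spectrum lies
  in the open positive half-line.
\<close>

definition op_powr :: "('a::chilbert_space \<Rightarrow>\<^sub>L 'a) \<Rightarrow> real \<Rightarrow> ('a \<Rightarrow>\<^sub>L 'a)" where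
  "op_powr A s = cfc (\<lambda>t. t powr s) A"

definition op_gmean ::
    "real \<Rightarrow> ('a::chilbert_space \<Rightarrow>\<^sub>L 'a) \<Rightarrow> ('a \<Rightarrow>\<^sub>L 'a) \<Rightarrow> ('a \<Rightarrow>\<^sub>L 'a)" where
  "op_gmean \<nu> A B =
     op_powr A (1/2) o\<^sub>L
     op_powr (op_powr A (- 1/2) o\<^sub>L B o\<^sub>L op_powr A (- 1/2)) \<nu> o\<^sub>L
     op_powr A (1/2)"

definition specht_ratio :: "real \<Rightarrow> real" where
  "specht_ratio h = h powr (1 / (h - 1)) / (exp 1 * ln (h powr (1 / (h - 1))))"

definition log_mean :: "real \<Rightarrow> real \<Rightarrow> real" where
  "log_mean x y = (if x = y then x else (y - x) / (ln y - ln x))"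

end

(*
  Congruence with A^(1/2) turns the right-hand side into A^(1/2) g(T) A^(1/2), where
  T = A^(-1/2) B A^(-1/2) has spectrum in [1/h, h] and
    g(t) = (1 - nu) + nu t - t^nu - 2 r ((1 + t)/2 - t^(1/2)).
  Put s = t^(1/2) and phi_mu(s) = (1 - mu) + mu s - s^mu. Then g(t) is phi_(2 nu)(s) if nu <= 1/2
  and s phi_(2 nu - 1)(s) otherwise. On [1/k, k] with k = h^(1/2), phi_mu is largest at an endpoint,
  where a tangent line of exp bounds it by F = L(1, k) log S(k). Hence g(T) <= k F, so the
  right-hand side is at most k F A <= k F M, and k F M is the stated scalar.

  The functional calculus is well defined because norm (p(A)) <= sup |p| over the real spectrum for
  self-adjoint A. With c = norm C for C = p(A), the operator c^2 - C^2 is not invertible: vectors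
  on which C almost attains its norm are almost annihilated by it. A nonzero real polynomial q
  without zeros in the spectrum, however, has q(A) invertible: its linear factors are invertible by
  the choice of q, its quadratic factors (t - a)^2 + b^2 because they are coercive at A.
*)
theory Submission
  imports Defs "HOL-Computational_Algebra.Fundamental_Theorem_Algebra"
begin

subsection \<open>Self-adjoint and positive operators\<close>

interpretation blinfun_compose: bounded_bilinear "(o\<^sub>L)"
  by (rule bounded_bilinear_blinfun_compose)

lemma blinfun_compose_id [simp]: "A o\<^sub>L id_blinfun = A" "id_blinfun o\<^sub>L A = A"
  by (rule blinfun_eqI; simp)+

text \<open>The operator type is real-linear, so most arguments run in the underlying real inner
  product space; the complex structure enters only through \<open>clinear_op\<close>.\<close>

definition rinner :: "'a::chilbert_space \<Rightarrow> 'a \<Rightarrow> real" where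
  "rinner x y = Re (cinner x y)"

lemma rinner_commute: "rinner x y = rinner y x"
  unfolding rinner_def by (metis cinner_commute complex_cnj cnj.simps(1))

lemma rinner_add_right: "rinner x (y + z) = rinner x y + rinner x z"
  by (simp add: rinner_def cinner_add_right)

lemma rinner_add_left: "rinner (x + y) z = rinner x z + rinner y z"
  by (metis rinner_add_right rinner_commute)

lemma rinner_scaleR_right: "rinner x (t *\<^sub>R y) = t * rinner x y"
  by (simp add: rinner_def scaleR_scaleC cinner_scaleC_right)

lemma rinner_scaleR_left: "rinner (t *\<^sub>R x) y = t * rinner x y"
  by (metis rinner_scaleR_right rinner_commute)

lemma rinner_minus_right: "rinner x (- y) = - rinner x y"
  using rinner_scaleR_right[of x "-1" y] by simp

lemma rinner_minus_left: "rinner (- x) y = - rinner x y"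
  using rinner_scaleR_left[of "-1" x y] by simp

lemma rinner_diff_right: "rinner x (y - z) = rinner x y - rinner x z"
  using rinner_add_right[of x y "-z"] by (simp add: rinner_minus_right)

lemma rinner_diff_left: "rinner (x - y) z = rinner x z - rinner y z"
  by (metis rinner_diff_right rinner_commute)

lemmas rinner_simps = rinner_add_right rinner_add_left rinner_scaleR_right rinner_scaleR_left
  rinner_minus_right rinner_minus_left rinner_diff_right rinner_diff_left

lemma rinner_self: "rinner x x = (norm x)\<^sup>2"
proof -
  have "0 \<le> rinner x x"
    using cinner_nonneg[of x] unfolding rinner_def complex_nonneg_Reals_iff by simp
  then show ?thesis
    by (simp add: norm_eq_sqrt_cinner rinner_def)
qed

text \<open>Expresses the inner product by norms alone, so that its continuity follows from that of
  the norm.\<close>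

lemma rinner_polarization: "rinner x y = ((norm (x + y))\<^sup>2 - (norm (x - y))\<^sup>2) / 4"
  unfolding rinner_self[symmetric] by (simp add: rinner_simps rinner_commute[of y x])

lemma tendsto_rinner [tendsto_intros]:
  assumes "(f \<longlongrightarrow> x) F" and "(g \<longlongrightarrow> y) F"
  shows "((\<lambda>n. rinner (f n) (g n)) \<longlongrightarrow> rinner x y) F"
  unfolding rinner_polarization by (intro tendsto_intros assms) auto

lemma Im_cinner: "Im (cinner x y) = - rinner x (\<i> *\<^sub>C y)"
  by (simp add: rinner_def cinner_scaleC_right)

lemma scaleC_of_real: "complex_of_real t *\<^sub>C x = t *\<^sub>R x"
  by (simp add: scaleR_scaleC)

lemma scaleR_scaleC_commute: "t *\<^sub>R (c *\<^sub>C x) = c *\<^sub>C (t *\<^sub>R (x :: 'a::chilbert_space))"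
  by (simp add: scaleR_scaleC scaleC_scaleC mult.commute)

lemma scalar_op_of_real: "scalar_op (complex_of_real t) = t *\<^sub>R id_blinfun"
  by (rule blinfun_eqI) (simp add: scalar_op.rep_eq scaleC_of_real blinfun.scaleR_left)

section \<open>Closure properties of complex-linear and self-adjoint operators\<close>

lemma clinear_op_id: "clinear_op id_blinfun"
  by (simp add: clinear_op_def)

lemma clinear_op_add: "clinear_op A \<Longrightarrow> clinear_op B \<Longrightarrow> clinear_op (A + B)"
  by (simp add: clinear_op_def blinfun.add_left scaleC_add_right)

lemma clinear_op_scaleR: "clinear_op A \<Longrightarrow> clinear_op (t *\<^sub>R A)"
  by (simp add: clinear_op_def blinfun.scaleR_left scaleR_scaleC_commute)

lemma clinear_op_compose: "clinear_op A \<Longrightarrow> clinear_op B \<Longrightarrow> clinear_op (A o\<^sub>L B)"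
  by (simp add: clinear_op_def)

text \<open>The imaginary part of the inner product with \<open>y\<close> is, up to sign, the real
  part with \<open>\<i> *\<^sub>C y\<close>. For complex-linear \<open>A\<close> the real identity
  therefore carries the complex one.\<close>

lemma selfadjoint_op_iff:
  "selfadjoint_op A \<longleftrightarrow>
     clinear_op A \<and> (\<forall>x y. rinner x (blinfun_apply A y) = rinner (blinfun_apply A x) y)"
  (is "_ \<longleftrightarrow> _ \<and> ?S")
proof -
  have "cinner x (blinfun_apply A y) = cinner (blinfun_apply A x) y" if "clinear_op A" ?S for x y
  proof (rule complex_eqI)
    show "Re (cinner x (blinfun_apply A y)) = Re (cinner (blinfun_apply A x) y)"
      using that(2) by (simp add: rinner_def)
    have "\<i> *\<^sub>C blinfun_apply A y = blinfun_apply A (\<i> *\<^sub>C y)"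
      using that(1) by (simp add: clinear_op_def)
    then show "Im (cinner x (blinfun_apply A y)) = Im (cinner (blinfun_apply A x) y)"
      using that(2) by (simp add: Im_cinner)
  qed
  then show ?thesis
    unfolding selfadjoint_op_def by (auto simp: rinner_def)
qed

lemma selfadjoint_op_clinear: "selfadjoint_op A \<Longrightarrow> clinear_op A"
  by (simp add: selfadjoint_op_iff)

lemma selfadjoint_op_rinner:
  "selfadjoint_op A \<Longrightarrow> rinner x (blinfun_apply A y) = rinner (blinfun_apply A x) y"
  by (simp add: selfadjoint_op_iff)

lemma selfadjoint_op_id: "selfadjoint_op id_blinfun"
  by (simp add: selfadjoint_op_iff clinear_op_id)

lemma selfadjoint_op_add: "selfadjoint_op A \<Longrightarrow> selfadjoint_op B \<Longrightarrow> selfadjoint_op (A + B)"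
  by (simp add: selfadjoint_op_iff clinear_op_add blinfun.add_left rinner_simps)

lemma selfadjoint_op_scaleR: "selfadjoint_op A \<Longrightarrow> selfadjoint_op (t *\<^sub>R A)"
  by (simp add: selfadjoint_op_iff clinear_op_scaleR blinfun.scaleR_left rinner_simps)

lemma selfadjoint_op_zero: "selfadjoint_op 0"
  using selfadjoint_op_scaleR[OF selfadjoint_op_id, of 0] by simp

lemma selfadjoint_op_diff: "selfadjoint_op A \<Longrightarrow> selfadjoint_op B \<Longrightarrow> selfadjoint_op (A - B)"
  using selfadjoint_op_add[of A "(-1) *\<^sub>R B"] selfadjoint_op_scaleR[of B "-1"] by simp

lemma selfadjoint_op_compose_commute:
  "selfadjoint_op A \<Longrightarrow> selfadjoint_op B \<Longrightarrow> A o\<^sub>L B = B o\<^sub>L A \<Longrightarrow> selfadjoint_op (A o\<^sub>L B)"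
  unfolding selfadjoint_op_iff
  by (metis blinfun_apply_blinfun_compose clinear_op_compose)

lemma selfadjoint_op_sandwich:
  "selfadjoint_op C \<Longrightarrow> selfadjoint_op A \<Longrightarrow> selfadjoint_op (C o\<^sub>L A o\<^sub>L C)"
  by (simp add: selfadjoint_op_iff clinear_op_compose)

lemma tendsto_blinfun_apply:
  "T \<longlonglongrightarrow> S \<Longrightarrow> (\<lambda>n. blinfun_apply (T n) x) \<longlonglongrightarrow> blinfun_apply S x"
  by (intro tendsto_intros)

text \<open>Complex linearity and symmetry are equations between expressions continuous in the
  operator, so they pass to limits. This makes every operator built by the functional calculus
  self-adjoint.\<close>

lemma selfadjoint_op_LIMSEQ:
  assumes "\<And>n. selfadjoint_op (T n)" and "T \<longlonglongrightarrow> S"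
  shows "selfadjoint_op S"
  unfolding selfadjoint_op_iff clinear_op_def
proof (intro conjI allI)
  fix c x
  have "bounded_linear (\<lambda>y::'a. c *\<^sub>C y)"
    using blinfun.bounded_linear_right[of "scalar_op c"] by (simp add: scalar_op.rep_eq)
  then have "(\<lambda>n. c *\<^sub>C blinfun_apply (T n) x) \<longlonglongrightarrow> c *\<^sub>C blinfun_apply S x"
    by (rule bounded_linear.tendsto) (intro tendsto_blinfun_apply assms)
  moreover have "(\<lambda>n. c *\<^sub>C blinfun_apply (T n) x) \<longlonglongrightarrow> blinfun_apply S (c *\<^sub>C x)"
    using tendsto_blinfun_apply[OF assms(2), of "c *\<^sub>C x"] selfadjoint_op_clinear[OF assms(1)]
    by (simp add: clinear_op_def)
  ultimately show "blinfun_apply S (c *\<^sub>C x) = c *\<^sub>C blinfun_apply S x"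
    by (metis LIMSEQ_unique)
next
  fix x y
  have "(\<lambda>n. rinner x (blinfun_apply (T n) y)) \<longlonglongrightarrow> rinner x (blinfun_apply S y)"
    by (intro tendsto_intros tendsto_blinfun_apply assms)
  moreover have "(\<lambda>n. rinner (blinfun_apply (T n) x) y) \<longlonglongrightarrow> rinner (blinfun_apply S x) y"
    by (intro tendsto_intros tendsto_blinfun_apply assms)
  ultimately show "rinner x (blinfun_apply S y) = rinner (blinfun_apply S x) y"
    using selfadjoint_op_rinner[OF assms(1)] by (simp add: LIMSEQ_unique)
qed

text \<open>By symmetry the quadratic form equals its own conjugate, so only the sign of its real
  part is left to control.\<close>

lemma positive_op_iff:
  "positive_op A \<longleftrightarrow> selfadjoint_op A \<and> (\<forall>x. 0 \<le> rinner x (blinfun_apply A x))"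
proof -
  have "Im (cinner x (blinfun_apply A x)) = 0" if "selfadjoint_op A" for x
    using that cinner_commute[of x "blinfun_apply A x"]
    by (auto simp: selfadjoint_op_def dest: arg_cong[of _ _ Im])
  then show ?thesis
    unfolding positive_op_def complex_nonneg_Reals_iff rinner_def by auto
qed

lemma op_ge_iff:
  "A \<succeq> B \<longleftrightarrow> selfadjoint_op (A - B) \<and>
     (\<forall>x. rinner x (blinfun_apply B x) \<le> rinner x (blinfun_apply A x))"
  by (simp add: op_ge_def positive_op_iff blinfun.diff_left rinner_simps)

subsection \<open>Invertibility\<close>

lemma invertible_op_compose:
  assumes "invertible_op A" and "invertible_op B"
  shows "invertible_op (A o\<^sub>L B)"
proof -
  obtain S T where S: "clinear_op S" "A o\<^sub>L S = id_blinfun" "S o\<^sub>L A = id_blinfun"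
    and T: "clinear_op T" "B o\<^sub>L T = id_blinfun" "T o\<^sub>L B = id_blinfun"
    using assms unfolding invertible_op_def by auto
  have *: "blinfun_apply A (blinfun_apply S x) = x" "blinfun_apply S (blinfun_apply A x) = x"
    "blinfun_apply B (blinfun_apply T x) = x" "blinfun_apply T (blinfun_apply B x) = x" for x
    using S(2,3) T(2,3)
    by (metis blinfun_apply_blinfun_compose blinfun_apply_id_blinfun)+
  show ?thesis
    unfolding invertible_op_def
    by (rule exI[of _ "T o\<^sub>L S"]) (auto simp: clinear_op_compose S T * intro!: blinfun_eqI)
qed

lemma invertible_op_scaleR:
  assumes "invertible_op A" and "t \<noteq> 0"
  shows "invertible_op (t *\<^sub>R A)"
proof -
  obtain S where S: "clinear_op S" "A o\<^sub>L S = id_blinfun" "S o\<^sub>L A = id_blinfun"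
    using assms unfolding invertible_op_def by auto
  show ?thesis
    unfolding invertible_op_def
    by (rule exI[of _ "(1 / t) *\<^sub>R S"])
      (simp add: S assms clinear_op_scaleR blinfun_compose.scaleR_left blinfun_compose.scaleR_right)
qed

text \<open>
  For small \<open>\<tau>\<close> the map \<open>x \<mapsto> x - \<tau> (P x - y)\<close> is a contraction, and its fixed point solves
  \<open>P x = y\<close>.
\<close>

lemma invertible_op_coercive:
  fixes P :: "'a::chilbert_space \<Rightarrow>\<^sub>L 'a"
  assumes P: "clinear_op P" and d: "0 < d"
    and coercive: "\<And>x. d * (norm x)\<^sup>2 \<le> rinner x (blinfun_apply P x)"
  shows "invertible_op P"
proof -
  \<comment> \<open>Adding \<open>d\<close> to the norm guarantees \<open>0 < K\<close> and
    \<open>d \<le> K\<close> without a separate case for the trivial space.\<close>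
  define K where "K = norm P + d"
  have K: "0 < K" "d \<le> K" "norm P \<le> K"
    using d norm_ge_zero[of P] unfolding K_def by linarith+
  \<comment> \<open>This step size minimizes
    \<open>1 - 2 * \<tau> * d + \<tau>\<^sup>2 * K\<^sup>2\<close>, the bound for the squared
    contraction factor; the minimum is the square of \<open>c\<close>.\<close>
  define \<tau> where "\<tau> = d / K\<^sup>2"
  define c where "c = sqrt (1 - d\<^sup>2 / K\<^sup>2)"
  have \<tau>: "0 < \<tau>"
    using K d by (simp add: \<tau>_def)
  have quot: "d\<^sup>2 / K\<^sup>2 \<le> 1" "0 < d\<^sup>2 / K\<^sup>2"
    using K d by (simp_all add: power_mono)
  have c: "0 \<le> c" "c < 1" "c\<^sup>2 = 1 - d\<^sup>2 / K\<^sup>2"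
    using quot by (auto simp: c_def)
  have contraction: "norm (x - \<tau> *\<^sub>R blinfun_apply P x) \<le> c * norm x" for x
  proof -
    have "(norm (blinfun_apply P x))\<^sup>2 \<le> (K * norm x)\<^sup>2"
    proof (rule power_mono)
      have "norm (blinfun_apply P x) \<le> norm P * norm x"
        by (rule norm_blinfun)
      also have "\<dots> \<le> K * norm x"
        using K(3) by (rule mult_right_mono) simp
      finally show "norm (blinfun_apply P x) \<le> K * norm x" .
    qed simp
    then have "\<tau>\<^sup>2 * (norm (blinfun_apply P x))\<^sup>2 \<le> \<tau>\<^sup>2 * (K * norm x)\<^sup>2"
      by (intro mult_left_mono) auto
    also have "\<dots> = d\<^sup>2 / K\<^sup>2 * (norm x)\<^sup>2"
      using K(1) by (simp add: \<tau>_def power2_eq_square)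
    finally have 1: "\<tau>\<^sup>2 * (norm (blinfun_apply P x))\<^sup>2 \<le> d\<^sup>2 / K\<^sup>2 * (norm x)\<^sup>2" .
    have "\<tau> * (d * (norm x)\<^sup>2) \<le> \<tau> * rinner x (blinfun_apply P x)"
      using \<tau> coercive by (intro mult_left_mono) auto
    moreover have "\<tau> * (d * (norm x)\<^sup>2) = d\<^sup>2 / K\<^sup>2 * (norm x)\<^sup>2"
      by (simp add: \<tau>_def power2_eq_square)
    ultimately have 2: "d\<^sup>2 / K\<^sup>2 * (norm x)\<^sup>2 \<le> \<tau> * rinner x (blinfun_apply P x)"
      by linarith
    have "(norm (x - \<tau> *\<^sub>R blinfun_apply P x))\<^sup>2
        = (norm x)\<^sup>2 - 2 * (\<tau> * rinner x (blinfun_apply P x)) + \<tau>\<^sup>2 * (norm (blinfun_apply P x))\<^sup>2"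
      unfolding rinner_self[symmetric]
      by (simp add: rinner_simps rinner_commute[of "blinfun_apply P x" x] power2_eq_square algebra_simps)
    also have "\<dots> \<le> (norm x)\<^sup>2 - d\<^sup>2 / K\<^sup>2 * (norm x)\<^sup>2"
      using 1 2 by linarith
    also have "\<dots> = (c * norm x)\<^sup>2"
      by (simp add: power_mult_distrib c(3) left_diff_distrib)
    finally show ?thesis
      by (rule power2_le_imp_le) (use c in auto)
  qed
  \<comment> \<open>The contraction estimate read backwards: \<open>P\<close> is bounded below,
    which yields injectivity and the boundedness of the inverse.\<close>
  have bound: "(1 - c) * norm x \<le> \<tau> * norm (blinfun_apply P x)" for x
  proof -
    have "norm x \<le> norm (x - \<tau> *\<^sub>R blinfun_apply P x) + norm (\<tau> *\<^sub>R blinfun_apply P x)"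
      by (metis diff_add_cancel norm_triangle_ineq)
    with contraction[of x] \<tau> show ?thesis
      by (simp add: left_diff_distrib)
  qed
  have inj: "inj (blinfun_apply P)"
  proof (rule injI)
    fix x y assume "blinfun_apply P x = blinfun_apply P y"
    then have "(1 - c) * norm (x - y) \<le> 0"
      using bound[of "x - y"] by (simp add: blinfun.diff_right)
    with c have "norm (x - y) \<le> 0"
      by (simp add: mult_le_0_iff)
    then show "x = y"
      by simp
  qed
  have surj: "\<exists>x. blinfun_apply P x = y" for y
  proof -
    have "\<exists>!x. x - \<tau> *\<^sub>R (blinfun_apply P x - y) = x"
    proof (rule banach_fix_type[OF c(1,2)], intro allI)
      fix x z
      have "x - \<tau> *\<^sub>R (blinfun_apply P x - y) - (z - \<tau> *\<^sub>R (blinfun_apply P z - y))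
          = (x - z) - \<tau> *\<^sub>R blinfun_apply P (x - z)"
        by (simp add: blinfun.diff_right algebra_simps)
      then show "dist (x - \<tau> *\<^sub>R (blinfun_apply P x - y)) (z - \<tau> *\<^sub>R (blinfun_apply P z - y))
          \<le> c * dist x z"
        unfolding dist_norm by (metis contraction)
    qed
    then show ?thesis
      using \<tau> by auto
  qed
  define Q where "Q = inv (blinfun_apply P)"
  have PQ: "blinfun_apply P (Q y) = y" for y
    unfolding Q_def by (metis f_inv_into_f rangeI surj)
  have QP: "Q (blinfun_apply P x) = x" for x
    unfolding Q_def by (rule inv_f_f[OF inj])
  have "bounded_linear Q"
  proof (rule bounded_linear_intro[where K = "\<tau> / (1 - c)"])
    show "Q (x + y) = Q x + Q y" for x y
      by (metis PQ QP blinfun.add_right)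
    show "Q (r *\<^sub>R x) = r *\<^sub>R Q x" for r x
      by (metis PQ QP blinfun.scaleR_right)
    show "norm (Q x) \<le> norm x * (\<tau> / (1 - c))" for x
      using bound[of "Q x"] c by (simp add: PQ field_simps)
  qed
  then have Q: "blinfun_apply (Blinfun Q) = Q"
    by (rule bounded_linear_Blinfun_apply)
  have "Q (c *\<^sub>C x) = c *\<^sub>C Q x" for c x
    using P by (metis PQ QP clinear_op_def)
  then show ?thesis
    unfolding invertible_op_def
    by (intro exI[of _ "Blinfun Q"]) (auto simp: clinear_op_def Q PQ QP intro!: blinfun_eqI)
qed


subsection \<open>Polynomials of a self-adjoint operator\<close>

text \<open>\<open>pCons c p\<close> has degree 0 when \<open>p = 0\<close>, not
  \<open>Suc (degree p)\<close>; a freely chosen upper limit spares the recursion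
  \<open>poly_op_pCons\<close> this case.\<close>

lemma poly_op_altdef:
  assumes "degree p \<le> n"
  shows "poly_op p A = (\<Sum>i\<le>n. coeff p i *\<^sub>R (((o\<^sub>L) A) ^^ i) id_blinfun)"
  unfolding poly_op_def
  by (rule sum.mono_neutral_left) (use assms in \<open>auto simp: coeff_eq_0\<close>)

lemma poly_op_0 [simp]: "poly_op 0 A = 0"
  by (simp add: poly_op_def)

lemma poly_op_pCons: "poly_op (pCons c p) A = c *\<^sub>R id_blinfun + (A o\<^sub>L poly_op p A)"
proof -
  have "poly_op (pCons c p) A =
      (\<Sum>i\<le>Suc (degree p). coeff (pCons c p) i *\<^sub>R (((o\<^sub>L) A) ^^ i) id_blinfun)"
    by (rule poly_op_altdef) (simp add: degree_pCons_le)
  also have "\<dots> = c *\<^sub>R id_blinfun +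
      (\<Sum>i\<le>degree p. coeff p i *\<^sub>R (A o\<^sub>L (((o\<^sub>L) A) ^^ i) id_blinfun))"
    by (simp only: sum.atMost_Suc_shift) simp
  finally show ?thesis
    by (simp add: poly_op_def blinfun_compose.sum_right blinfun_compose.scaleR_right)
qed

lemma poly_op_X: "poly_op [:0, 1:] A = A"
  by (rule blinfun_eqI) (simp add: poly_op_pCons)

lemma poly_op_add: "poly_op (p + q) A = poly_op p A + poly_op q A"
proof (induction p arbitrary: q)
  case (pCons c p)
  then show ?case
    by (cases q) (simp_all add: poly_op_pCons blinfun_compose.add_right scaleR_add_left)
qed simp

lemma poly_op_smult: "poly_op (smult c p) A = c *\<^sub>R poly_op p A"
  by (induction p) (simp_all add: poly_op_pCons blinfun_compose.scaleR_right scaleR_add_right)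

lemma poly_op_diff: "poly_op (p - q) A = poly_op p A - poly_op q A"
  using poly_op_add[of p "- q" A] poly_op_smult[of "-1" q A] by simp

lemma poly_op_mult: "poly_op (p * q) A = poly_op p A o\<^sub>L poly_op q A"
proof (induction p)
  case (pCons c p)
  have "poly_op (pCons c p * q) A = c *\<^sub>R poly_op q A + (A o\<^sub>L (poly_op p A o\<^sub>L poly_op q A))"
    by (simp add: poly_op_add poly_op_smult poly_op_pCons pCons.IH)
  then show ?case
    by (auto intro!: blinfun_eqI simp: poly_op_pCons blinfun.add_left blinfun.scaleR_left)
qed simp

lemma selfadjoint_poly_op:
  assumes "selfadjoint_op A"
  shows "selfadjoint_op (poly_op p A)"
proof (induction p)
  case (pCons c p)
  \<comment> \<open>A product of self-adjoint operators is self-adjoint once they commute; here both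
    products are the value at \<open>A\<close> of \<open>p\<close> times the indeterminate.\<close>
  have "A o\<^sub>L poly_op p A = poly_op p A o\<^sub>L A"
    using poly_op_mult[of "[:0, 1:]" p A] poly_op_mult[of p "[:0, 1:]" A]
    by (simp add: poly_op_X)
  then show ?case
    by (auto simp: poly_op_pCons assms pCons.IH
        intro!: selfadjoint_op_add selfadjoint_op_scaleR selfadjoint_op_id selfadjoint_op_compose_commute)
qed (simp add: selfadjoint_op_zero)

section \<open>Real polynomials at complex points, and their real factors\<close>

lemma poly_map_poly_of_real_add:
  "poly (map_poly complex_of_real (p + q)) z =
     poly (map_poly complex_of_real p) z + poly (map_poly complex_of_real q) z"
proof (induction p arbitrary: q)
  case (pCons c p)
  then show ?case
    by (cases q) (simp_all add: map_poly_pCons algebra_simps)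
qed simp

lemma poly_map_poly_of_real_mult:
  "poly (map_poly complex_of_real (p * q)) z =
     poly (map_poly complex_of_real p) z * poly (map_poly complex_of_real q) z"
proof -
  have smult: "poly (map_poly complex_of_real (smult c q)) z =
      complex_of_real c * poly (map_poly complex_of_real q) z" for c q
    by (induction q) (simp_all add: map_poly_pCons algebra_simps)
  show ?thesis
    by (induction p) (simp_all add: map_poly_pCons poly_map_poly_of_real_add smult algebra_simps)
qed

text \<open>A complex root exists by the fundamental theorem of algebra. If it is not real, division
  by its real quadratic leaves a remainder of degree at most 1 that still vanishes there, which
  forces the remainder to be 0.\<close>

lemma real_poly_root_or_quadratic_factor:
  fixes q :: "real poly"
  assumes "degree q \<noteq> 0"
  obtains (root) t where "poly q t = 0"
  | (quadratic) a b where "b \<noteq> 0" "[:a\<^sup>2 + b\<^sup>2, - 2 * a, 1:] dvd q"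
proof -
  define ev where "ev p z = poly (map_poly complex_of_real p) z" for p z
  have "degree (map_poly complex_of_real q) \<noteq> 0"
    using assms by (simp add: degree_map_poly)
  then obtain z where z: "ev q z = 0"
    using fundamental_theorem_of_algebra[of "map_poly complex_of_real q"]
    unfolding constant_degree ev_def by blast
  show ?thesis
  proof (cases "Im z = 0")
    case True
    then have "z = complex_of_real (Re z)"
      by (simp add: complex_eq_iff)
    moreover have "ev q (complex_of_real t) = complex_of_real (poly q t)" for t
      unfolding ev_def by (induction q) (simp_all add: map_poly_pCons)
    ultimately show ?thesis
      using z root by (metis of_real_eq_0_iff)
  next
    case False
    define d where "d = [:(Re z)\<^sup>2 + (Im z)\<^sup>2, - 2 * Re z, 1:]"
    have d: "ev d z = 0"
      by (simp add: ev_def d_def map_poly_pCons complex_eq_iff power2_eq_square algebra_simps)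
    have "ev q z = ev (q div d * d + q mod d) z"
      by simp
    then have rem: "ev (q mod d) z = 0"
      using z d unfolding ev_def poly_map_poly_of_real_add poly_map_poly_of_real_mult by simp
    have "q mod d = 0"
    proof (rule ccontr)
      assume "q mod d \<noteq> 0"
      then have "degree (q mod d) < degree d"
        using degree_mod_less[of d q] by (auto simp: d_def)
      then have "degree (q mod d) \<le> 1"
        by (simp add: d_def)
      define a b where "a = coeff (q mod d) 0" and "b = coeff (q mod d) 1"
      have ab: "q mod d = [:a, b:]"
      proof (rule poly_eqI)
        fix n
        show "coeff (q mod d) n = coeff [:a, b:] n"
          using \<open>degree (q mod d) \<le> 1\<close>
          by (cases n; cases "n - 1") (auto simp: a_def b_def coeff_eq_0)
      qed
      \<comment> \<open>The imaginary part of \<open>a + b * z\<close> is \<open>b * Im z\<close>,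
        and \<open>Im z\<close> is nonzero; then the real part gives \<open>a = 0\<close>.\<close>
      have "b = 0"
        using rem False by (auto simp: ev_def ab map_poly_pCons complex_eq_iff)
      then have "q mod d = 0"
        using rem by (auto simp: ev_def ab map_poly_pCons complex_eq_iff)
      with \<open>q mod d \<noteq> 0\<close> show False ..
    qed
    then have "d dvd q"
      by auto
    then show ?thesis
      using quadratic[OF False] by (simp add: d_def)
  qed
qed

text \<open>Induction on the degree, splitting off one real factor at a time. Only real spectral
  points have to be avoided, because the quadratic factors coming from nonreal roots are always
  invertible at \<open>A\<close>.\<close>

lemma invertible_poly_op:
  fixes A :: "'a::chilbert_space \<Rightarrow>\<^sub>L 'a"
  assumes A: "selfadjoint_op A"
  shows "q \<noteq> 0 \<Longrightarrow> (\<And>t. complex_of_real t \<in> spectrum_op A \<Longrightarrow> poly q t \<noteq> 0) \<Longrightarrow>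
    invertible_op (poly_op q A)"
proof (induction "degree q" arbitrary: q rule: less_induct)
  case less
  \<comment> \<open>Zeros of the cofactor are zeros of \<open>q\<close>, so the induction hypothesis
    applies to it.\<close>
  have step: "invertible_op (poly_op q A)"
    if dvd: "d dvd q" and inv: "invertible_op (poly_op d A)" and deg: "degree d \<noteq> 0" for d
  proof -
    obtain u where u: "q = d * u"
      using dvd by blast
    with less.prems(1) have "d \<noteq> 0" "u \<noteq> 0"
      by auto
    then have "degree u < degree q"
      using deg by (simp add: u degree_mult_eq)
    moreover have "poly u t \<noteq> 0" if "complex_of_real t \<in> spectrum_op A" for t
      using less.prems(2)[OF that] by (simp add: u)
    ultimately have "invertible_op (poly_op u A)"
      using less.hyps \<open>u \<noteq> 0\<close> by blast
    then show ?thesis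
      by (simp add: u poly_op_mult invertible_op_compose inv)
  qed
  show ?case
  proof (cases "degree q = 0")
    case True
    then obtain c where c: "q = [:c:]"
      by (rule degree_eq_zeroE)
    have "invertible_op (id_blinfun :: 'a \<Rightarrow>\<^sub>L 'a)"
      unfolding invertible_op_def using clinear_op_id by (intro exI[of _ id_blinfun]) auto
    then show ?thesis
      using less.prems(1) by (simp add: c poly_op_pCons invertible_op_scaleR)
  next
    case False
    then show ?thesis
    proof (cases q rule: real_poly_root_or_quadratic_factor)
      case (root t)
      then have "invertible_op (A - scalar_op (complex_of_real t))"
        using less.prems(2)[of t] by (auto simp: spectrum_op_def)
      moreover have "poly_op [:- t, 1:] A = A - t *\<^sub>R id_blinfun"
        by (rule blinfun_eqI) (simp add: poly_op_pCons blinfun.bilinear_simps)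
      ultimately have "invertible_op (poly_op [:- t, 1:] A)"
        by (simp add: scalar_op_of_real)
      moreover have "[:- t, 1:] dvd q"
        using root by (simp add: poly_eq_0_iff_dvd)
      ultimately show ?thesis
        by (intro step) auto
    next
      case (quadratic a b)
      let ?D = "poly_op [:a\<^sup>2 + b\<^sup>2, - 2 * a, 1:] A"
      \<comment> \<open>\<open>?D\<close> is the square of \<open>A - a\<close> plus
        \<open>b\<^sup>2\<close>; by symmetry the square contributes a squared norm to the quadratic
        form.\<close>
      have "b\<^sup>2 * (norm x)\<^sup>2 \<le> rinner x (blinfun_apply ?D x)" for x
      proof -
        have "(norm (blinfun_apply A x - a *\<^sub>R x))\<^sup>2 = rinner x (blinfun_apply ?D x) - b\<^sup>2 * (norm x)\<^sup>2"
          unfolding rinner_self[symmetric]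
          by (simp add: poly_op_pCons blinfun.bilinear_simps rinner_simps
              selfadjoint_op_rinner[OF A]
              power2_eq_square algebra_simps)
        then show ?thesis
          using zero_le_power2[of "norm (blinfun_apply A x - a *\<^sub>R x)"] by linarith
      qed
      then have "invertible_op ?D"
        using quadratic(1) by (intro invertible_op_coercive[of _ "b\<^sup>2"])
          (auto intro: selfadjoint_op_clinear selfadjoint_poly_op A)
      then show ?thesis
        by (intro step[OF quadratic(2)]) auto
    qed
  qed
qed

text \<open>An inverse would bound \<open>norm x\<close> by the norm of \<open>?D\<close> at
  \<open>x\<close>, which is small where \<open>C\<close> nearly attains its norm; quantitatively,
  \<open>C\<close> would have norm strictly below \<open>norm C\<close>. The vector
  \<open>x0\<close> excludes the zero space, where every operator is invertible.\<close>

lemma not_invertible_norm_diff_square: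
  fixes C :: "'a::chilbert_space \<Rightarrow>\<^sub>L 'a"
  assumes C: "selfadjoint_op C" and nontrivial: "(x0 :: 'a) \<noteq> 0"
  shows "\<not> invertible_op ((norm C)\<^sup>2 *\<^sub>R id_blinfun - (C o\<^sub>L C))" (is "\<not> invertible_op ?D")
proof
  assume "invertible_op ?D"
  then obtain S where S: "S o\<^sub>L ?D = id_blinfun"
    unfolding invertible_op_def by blast
  define c K where "c = norm C" and "K = norm S"
  have c0: "0 \<le> c" and K0: "0 \<le> K"
    by (simp_all add: c_def K_def)
  \<comment> \<open>Expanding the squared norm of \<open>?D\<close> at \<open>x\<close> and
    estimating \<open>C\<close> at \<open>?y\<close> by \<open>c * norm ?y\<close> absorbs one of
    the two negative cross terms.\<close>
  have key: "(norm x)\<^sup>2 \<le> K\<^sup>2 * c\<^sup>2 * (c\<^sup>2 * (norm x)\<^sup>2 - (norm (blinfun_apply C x))\<^sup>2)" for x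
  proof -
    let ?y = "blinfun_apply C x"
    have "norm x = norm (blinfun_apply S (blinfun_apply ?D x))"
      by (metis S blinfun_apply_blinfun_compose blinfun_apply_id_blinfun)
    also have "\<dots> \<le> K * norm (blinfun_apply ?D x)"
      unfolding K_def by (rule norm_blinfun)
    finally have "(norm x)\<^sup>2 \<le> (K * norm (blinfun_apply ?D x))\<^sup>2"
      by (intro power_mono) auto
    also have "\<dots> = K\<^sup>2 * (norm (blinfun_apply ?D x))\<^sup>2"
      by (simp add: power_mult_distrib)
    finally have 1: "(norm x)\<^sup>2 \<le> K\<^sup>2 * (norm (blinfun_apply ?D x))\<^sup>2" .
    have 2: "(norm (blinfun_apply ?D x))\<^sup>2
        = c\<^sup>2 * (c\<^sup>2 * (norm x)\<^sup>2) - 2 * (c\<^sup>2 * (norm ?y)\<^sup>2) + (norm (blinfun_apply C ?y))\<^sup>2"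
      unfolding rinner_self[symmetric] c_def[symmetric]
      by (simp add: blinfun.bilinear_simps rinner_simps selfadjoint_op_rinner[OF C, of x]
          rinner_commute[of "blinfun_apply C ?y" x] algebra_simps)
    have "(norm (blinfun_apply C ?y))\<^sup>2 \<le> (c * norm ?y)\<^sup>2"
      unfolding c_def by (intro power_mono norm_blinfun) auto
    with 2 have "(norm (blinfun_apply ?D x))\<^sup>2 \<le> c\<^sup>2 * (c\<^sup>2 * (norm x)\<^sup>2 - (norm ?y)\<^sup>2)"
      by (simp add: power_mult_distrib right_diff_distrib)
    then have "K\<^sup>2 * (norm (blinfun_apply ?D x))\<^sup>2 \<le> K\<^sup>2 * (c\<^sup>2 * (c\<^sup>2 * (norm x)\<^sup>2 - (norm ?y)\<^sup>2))"
      by (rule mult_left_mono) simp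
    with 1 show ?thesis
      by (simp add: mult.assoc)
  qed
  have Kc: "0 < K\<^sup>2 * c\<^sup>2"
  proof (rule ccontr)
    assume "\<not> 0 < K\<^sup>2 * c\<^sup>2"
    then have "K\<^sup>2 * c\<^sup>2 = 0"
      using zero_le_power2[of "K * c"] unfolding power_mult_distrib by linarith
    then have "(norm x0)\<^sup>2 \<le> 0"
      using key[of x0] by (simp only: mult_zero_left)
    then show False
      using nontrivial by simp
  qed
  \<comment> \<open>\<open>key\<close> solved for the squared norm of \<open>C\<close> at
    \<open>x\<close>; the constant \<open>e\<close> lies strictly below
    \<open>c\<^sup>2\<close>.\<close>
  define e where "e = c\<^sup>2 - 1 / (K\<^sup>2 * c\<^sup>2)"
  have bound: "(norm (blinfun_apply C x))\<^sup>2 \<le> e * (norm x)\<^sup>2" for x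
  proof -
    have "(norm x)\<^sup>2 / (K\<^sup>2 * c\<^sup>2) \<le> c\<^sup>2 * (norm x)\<^sup>2 - (norm (blinfun_apply C x))\<^sup>2"
      using key[of x] Kc by (subst pos_divide_le_eq) (auto simp: mult.commute)
    then show ?thesis
      by (simp add: e_def left_diff_distrib)
  qed
  have "0 \<le> e * (norm x0)\<^sup>2"
    using bound[of x0] by (meson order_trans zero_le_power2)
  with nontrivial have e: "0 \<le> e"
    by (simp add: zero_le_mult_iff)
  have "norm C \<le> sqrt e"
  proof (rule norm_blinfun_bound)
    show "norm (blinfun_apply C x) \<le> sqrt e * norm x" for x
      by (rule power2_le_imp_le) (use bound e in \<open>auto simp: power_mult_distrib\<close>)
  qed (use e in simp)
  then have "c\<^sup>2 \<le> e"
    using c0 e by (metis c_def power_mono real_sqrt_pow2)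
  then show False
    using Kc by (simp add: e_def divide_le_0_iff)
qed

text \<open>If no real number were spectral, \<open>invertible_poly_op\<close> would apply vacuously
  to \<open>(norm A)\<^sup>2\<close> minus the square of the indeterminate.\<close>

lemma ex_real_spectrum:
  fixes A :: "'a::chilbert_space \<Rightarrow>\<^sub>L 'a"
  assumes A: "selfadjoint_op A" and nontrivial: "(x0 :: 'a) \<noteq> 0"
  shows "\<exists>t. complex_of_real t \<in> spectrum_op A"
proof (rule ccontr)
  assume "\<not> ?thesis"
  then have "invertible_op (poly_op ([:(norm A)\<^sup>2:] - [:0, 1:] * [:0, 1:]) A)"
    by (intro invertible_poly_op[OF A]) auto
  then have "invertible_op ((norm A)\<^sup>2 *\<^sub>R id_blinfun - (A o\<^sub>L A))"
    by (simp only: poly_op_diff poly_op_mult poly_op_X)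
      (simp only: poly_op_pCons poly_op_0 blinfun_compose.zero_right add_0_right)
  with not_invertible_norm_diff_square[OF assms] show False ..
qed

text \<open>If the norm exceeded \<open>e\<close>, the polynomial
  \<open>(norm C)\<^sup>2 - p\<^sup>2\<close> would be positive on the real spectrum, hence
  invertible at \<open>A\<close>. This estimate drives both existence and uniqueness of the
  functional calculus. On the zero space the spectrum is empty and \<open>0 \<le> e\<close> gives
  the bound.\<close>

lemma norm_poly_op_le:
  fixes A :: "'a::chilbert_space \<Rightarrow>\<^sub>L 'a"
  assumes A: "selfadjoint_op A" and e: "0 \<le> e"
    and le: "\<And>t. complex_of_real t \<in> spectrum_op A \<Longrightarrow> \<bar>poly p t\<bar> \<le> e"
  shows "norm (poly_op p A) \<le> e"
proof (rule ccontr)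
  define C where "C = poly_op p A"
  assume "\<not> ?thesis"
  then have less: "e < norm C"
    by (simp add: C_def)
  then have "C \<noteq> 0"
    using e by auto
  then obtain x0 where "blinfun_apply C x0 \<noteq> 0"
    by (metis blinfun_eqI blinfun.zero_left)
  then have x0: "x0 \<noteq> 0"
    by auto
  define q where "q = [:(norm C)\<^sup>2:] - p * p"
  have q: "0 < poly q t" if "complex_of_real t \<in> spectrum_op A" for t
  proof -
    have "\<bar>poly p t\<bar> < norm C"
      using le[OF that] less by linarith
    then have "(poly p t)\<^sup>2 < (norm C)\<^sup>2"
      by (metis abs_ge_zero power2_abs power_strict_mono zero_less_numeral)
    then show ?thesis
      by (simp add: q_def power2_eq_square)
  qed
  \<comment> \<open>Positivity on the spectrum excludes \<open>q = 0\<close> because the real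
    spectrum is nonempty.\<close>
  moreover have "q \<noteq> 0"
    using ex_real_spectrum[OF A x0] q by force
  ultimately have "invertible_op (poly_op q A)"
    by (intro invertible_poly_op[OF A]) force+
  then have "invertible_op ((norm C)\<^sup>2 *\<^sub>R id_blinfun - (C o\<^sub>L C))"
    by (simp add: q_def C_def poly_op_diff poly_op_mult poly_op_pCons)
  then show False
    using not_invertible_norm_diff_square[OF _ x0] selfadjoint_poly_op[OF A] C_def by blast
qed


subsection \<open>Continuous functional calculus\<close>

text \<open>The relation under the description operator in \<open>cfc\<close>, with the set of
  uniform convergence as a parameter: algebraic rules can be proved before existence and uniqueness,
  and an interval may replace the spectrum.\<close>

definition has_cfc ::
    "real set \<Rightarrow> (real \<Rightarrow> real) \<Rightarrow> ('a::chilbert_space \<Rightarrow>\<^sub>L 'a) \<Rightarrow> ('a \<Rightarrow>\<^sub>L 'a) \<Rightarrow> bool" where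
  "has_cfc S f A T \<longleftrightarrow>
     (\<exists>p. uniform_limit S (\<lambda>n. poly (p n)) f sequentially \<and> (\<lambda>n. poly_op (p n) A) \<longlonglongrightarrow> T)"

lemma cfc_eq_The_has_cfc: "cfc f A = (THE T. has_cfc {t. complex_of_real t \<in> spectrum_op A} f A T)"
  unfolding cfc_def has_cfc_def ..

section \<open>Algebraic rules for the functional calculus\<close>

lemma has_cfc_poly: "has_cfc S (poly p) A (poly_op p A)"
  unfolding has_cfc_def by (intro exI[of _ "\<lambda>n. p"]) (auto intro: uniform_limit_const)

lemma poly_const_fun [simp]: "poly [:c:] = (\<lambda>_. c)"
  by (rule ext) simp

lemma has_cfc_const: "has_cfc S (\<lambda>_. c) A (c *\<^sub>R id_blinfun)"
  using has_cfc_poly[of S "[:c:]" A] by (simp add: poly_op_pCons)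

lemma has_cfc_ident: "has_cfc S (\<lambda>t. t) A A"
  using has_cfc_poly[of S "[:0, 1:]" A] by (simp add: poly_op_X poly_pCons[abs_def])

lemma has_cfc_cong: "has_cfc S f A T \<Longrightarrow> (\<And>t. t \<in> S \<Longrightarrow> f t = g t) \<Longrightarrow> has_cfc S g A T"
  unfolding has_cfc_def by (metis (no_types, lifting) uniform_limit_cong')

lemma has_cfc_add:
  assumes "has_cfc S f A T" and "has_cfc S g A U"
  shows "has_cfc S (\<lambda>t. f t + g t) A (T + U)"
proof -
  obtain p q where p: "uniform_limit S (\<lambda>n. poly (p n)) f sequentially" "(\<lambda>n. poly_op (p n) A) \<longlonglongrightarrow> T"
    and q: "uniform_limit S (\<lambda>n. poly (q n)) g sequentially" "(\<lambda>n. poly_op (q n) A) \<longlonglongrightarrow> U"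
    using assms unfolding has_cfc_def by blast
  show ?thesis
    unfolding has_cfc_def
    using uniform_limit_add[OF p(1) q(1)] tendsto_add[OF p(2) q(2)]
    by (intro exI[of _ "\<lambda>n. p n + q n"]) (simp add: poly_op_add poly_add[abs_def])
qed

text \<open>The boundedness assumptions ensure that the product of the two uniform limits is again a
  uniform limit.\<close>

lemma has_cfc_mult:
  assumes "has_cfc S f A T" and "has_cfc S g A U"
    and "bounded (f ` S)" and "bounded (g ` S)"
  shows "has_cfc S (\<lambda>t. f t * g t) A (T o\<^sub>L U)"
proof -
  obtain p q where p: "uniform_limit S (\<lambda>n. poly (p n)) f sequentially" "(\<lambda>n. poly_op (p n) A) \<longlonglongrightarrow> T"
    and q: "uniform_limit S (\<lambda>n. poly (q n)) g sequentially" "(\<lambda>n. poly_op (q n) A) \<longlonglongrightarrow> U"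
    using assms unfolding has_cfc_def by blast
  show ?thesis
    unfolding has_cfc_def
    using uniform_lim_mult[OF p(1) q(1) assms(3,4)] blinfun_compose.tendsto[OF p(2) q(2)]
    by (intro exI[of _ "\<lambda>n. p n * q n"]) (simp add: poly_op_mult poly_mult[abs_def])
qed

lemma has_cfc_scaleR:
  assumes "has_cfc S f A T"
  shows "has_cfc S (\<lambda>t. c * f t) A (c *\<^sub>R T)"
proof -
  obtain p where p: "uniform_limit S (\<lambda>n. poly (p n)) f sequentially" "(\<lambda>n. poly_op (p n) A) \<longlonglongrightarrow> T"
    using assms unfolding has_cfc_def by blast
  show ?thesis
    unfolding has_cfc_def
    using bounded_linear.uniform_limit[OF bounded_linear_mult_right p(1), of c]
      tendsto_scaleR[OF tendsto_const p(2), of c]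
    by (intro exI[of _ "\<lambda>n. smult c (p n)"]) (simp add: poly_op_smult poly_smult[abs_def])
qed

lemma has_cfc_diff:
  "has_cfc S f A T \<Longrightarrow> has_cfc S g A U \<Longrightarrow> has_cfc S (\<lambda>t. f t - g t) A (T - U)"
  using has_cfc_add[of S f A T "\<lambda>t. (-1) * g t" "(-1) *\<^sub>R U"] has_cfc_scaleR[of S g A U "-1"] by simp

lemma selfadjoint_has_cfc: "has_cfc S f A T \<Longrightarrow> selfadjoint_op A \<Longrightarrow> selfadjoint_op T"
  unfolding has_cfc_def using selfadjoint_op_LIMSEQ[of "\<lambda>n. poly_op (p n) A" T for p] selfadjoint_poly_op
  by blast

lemma has_cfc_unique:
  assumes A: "selfadjoint_op A" and S: "{t. complex_of_real t \<in> spectrum_op A} \<subseteq> S"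
    and T: "has_cfc S f A T" and U: "has_cfc S f A U"
  shows "T = U"
proof -
  \<comment> \<open>The difference of two approximating sequences tends to 0 uniformly on the
    spectrum, so \<open>norm_poly_op_le\<close> forces the operator limit to be 0.\<close>
  obtain p where p: "uniform_limit S (\<lambda>n. poly (p n)) (\<lambda>t. f t - f t) sequentially"
      "(\<lambda>n. poly_op (p n) A) \<longlonglongrightarrow> T - U"
    using has_cfc_diff[OF T U] unfolding has_cfc_def by blast
  have "norm (T - U) \<le> 0"
  proof (rule field_le_epsilon)
    fix e :: real assume e: "0 < e"
    have "\<forall>\<^sub>F n in sequentially. norm (poly_op (p n) A) \<le> e"
      using uniform_limitD[OF p(1) e]
    proof eventually_elim
      case (elim n)
      with S e show ?case
        by (intro norm_poly_op_le[OF A]) (force simp: dist_norm)+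
    qed
    then have "norm (T - U) \<le> e"
      using tendsto_norm[OF p(2)] by (intro tendsto_upperbound[of _ _ sequentially]) auto
    then show "norm (T - U) \<le> 0 + e"
      by simp
  qed
  then show ?thesis
    by simp
qed

text \<open>A compact set enclosing the real spectrum stands in for it; the instances below are
  intervals read off from bounds on the quadratic form.\<close>

locale spectral_set =
  fixes A :: "'a::chilbert_space \<Rightarrow>\<^sub>L 'a" and S :: "real set"
  assumes selfadjoint: "selfadjoint_op A"
    and compact: "compact S"
    and spectrum: "{t. complex_of_real t \<in> spectrum_op A} \<subseteq> S"
begin

text \<open>Uniform convergence on \<open>S\<close> restricts to the spectrum, where uniqueness
  resolves the definite description.\<close>

lemma cfc_eqI:
  assumes "has_cfc S f A T"
  shows "cfc f A = T"
  unfolding cfc_eq_The_has_cfc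
proof (rule the_equality)
  let ?\<sigma> = "{t. complex_of_real t \<in> spectrum_op A}"
  show T: "has_cfc ?\<sigma> f A T"
    using assms spectrum unfolding has_cfc_def by (meson uniform_limit_on_subset)
  show "U = T" if "has_cfc ?\<sigma> f A U" for U
    using has_cfc_unique[OF selfadjoint order_refl that T] .
qed

text \<open>Stone-Weierstrass supplies approximating polynomials on the compact set; by
  \<open>norm_poly_op_le\<close> their values at \<open>A\<close> form a Cauchy sequence, which
  converges by completeness.\<close>

lemma has_cfc_cfc:
  assumes f: "continuous_on S f"
  shows "has_cfc S f A (cfc f A)"
proof -
  have "\<exists>p. \<forall>t\<in>S. \<bar>f t - poly p t\<bar> < 1 / Suc n" for n
  proof -
    obtain g where g: "real_polynomial_function g" "\<And>t. t \<in> S \<Longrightarrow> \<bar>f t - g t\<bar> < 1 / Suc n"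
      using Stone_Weierstrass_real_polynomial_function[OF compact f, of "1 / Suc n"] by auto
    obtain a N where a: "g = (\<lambda>t. \<Sum>i\<le>N. a i * t ^ i)"
      using g(1) unfolding real_polynomial_function_iff_sum by blast
    have "poly (\<Sum>i\<le>N. monom (a i) i) t = g t" for t
      by (simp add: a poly_sum poly_monom)
    with g(2) show ?thesis
      by metis
  qed
  then obtain p where p: "\<bar>f t - poly (p n) t\<bar> < 1 / Suc n" if "t \<in> S" for n t
    by metis
  have lim: "uniform_limit S (\<lambda>n. poly (p n)) f sequentially"
  proof (rule uniform_limitI)
    fix e :: real assume "0 < e"
    then obtain N where N: "1 / Suc N < e"
      using nat_approx_posE by blast
    show "\<forall>\<^sub>F n in sequentially. \<forall>t\<in>S. dist (poly (p n) t) (f t) < e"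
    proof (rule eventually_sequentiallyI[of N], intro ballI)
      fix n t assume "N \<le> n" "t \<in> S"
      then have "\<bar>f t - poly (p n) t\<bar> < 1 / Suc n" "1 / real (Suc n) \<le> 1 / real (Suc N)"
        using p by (auto intro!: divide_left_mono)
      with N show "dist (poly (p n) t) (f t) < e"
        by (simp add: dist_norm abs_minus_commute)
    qed
  qed
  have "Cauchy (\<lambda>n. poly_op (p n) A)"
  proof (rule metric_CauchyI)
    fix e :: real assume e: "0 < e"
    then obtain N where N: "dist (poly (p n) t) (f t) < e / 4" if "N \<le> n" "t \<in> S" for n t
      using uniform_limitD[OF lim, of "e / 4"] unfolding eventually_sequentially by auto
    have "dist (poly_op (p k) A) (poly_op (p n) A) < e" if "N \<le> k" "N \<le> n" for k n
    proof -
      \<comment> \<open>Two errors below \<open>e / 4\<close> add up to at most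
        \<open>e / 2\<close>; the slack turns the non-strict norm bound into a strict one.\<close>
      have "norm (poly_op (p k - p n) A) \<le> e / 2"
      proof (rule norm_poly_op_le[OF selfadjoint])
        fix t assume "complex_of_real t \<in> spectrum_op A"
        then have "t \<in> S"
          using spectrum by auto
        then show "\<bar>poly (p k - p n) t\<bar> \<le> e / 2"
          using N[OF that(1), of t] N[OF that(2), of t]
          unfolding dist_real_def poly_diff by linarith
      qed (use e in simp)
      with e show ?thesis
        by (simp add: dist_norm poly_op_diff)
    qed
    then show "\<exists>N. \<forall>k\<ge>N. \<forall>n\<ge>N. dist (poly_op (p k) A) (poly_op (p n) A) < e"
      by blast
  qed
  then obtain T where "(\<lambda>n. poly_op (p n) A) \<longlonglongrightarrow> T"
    using convergent_eq_Cauchy by blast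
  with lim have "has_cfc S f A T"
    unfolding has_cfc_def by blast
  then show ?thesis
    using cfc_eqI by simp
qed

lemma cfc_mult:
  assumes "continuous_on S f" and "continuous_on S g"
  shows "has_cfc S (\<lambda>t. f t * g t) A (cfc f A o\<^sub>L cfc g A)"
  using assms compact
  by (intro has_cfc_mult has_cfc_cfc compact_imp_bounded compact_continuous_image)

text \<open>With \<open>R\<close> the calculus of the square root of \<open>f\<close>, the operator
  is \<open>R o\<^sub>L R\<close> and its quadratic form is a squared norm.\<close>

lemma has_cfc_nonneg:
  assumes T: "has_cfc S f A T" and f: "continuous_on S f" and nonneg: "\<And>t. t \<in> S \<Longrightarrow> 0 \<le> f t"
  shows "0 \<le> rinner x (blinfun_apply T x)"
proof -
  define R where "R = cfc (\<lambda>t. sqrt (f t)) A"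
  have cont: "continuous_on S (\<lambda>t. sqrt (f t))"
    by (intro continuous_intros f)
  have "has_cfc S f A (R o\<^sub>L R)"
    unfolding R_def by (rule has_cfc_cong[OF cfc_mult[OF cont cont]]) (simp add: nonneg)
  then have "T = R o\<^sub>L R"
    using cfc_eqI T by blast
  moreover have "selfadjoint_op R"
    unfolding R_def using has_cfc_cfc[OF cont] selfadjoint by (rule selfadjoint_has_cfc)
  ultimately have "rinner x (blinfun_apply T x) = (norm (blinfun_apply R x))\<^sup>2"
    by (simp add: rinner_self[symmetric] selfadjoint_op_rinner[of R x])
  then show ?thesis
    by simp
qed

lemma has_cfc_mono:
  assumes "has_cfc S f A T" and "has_cfc S g A U"
    and "continuous_on S f" and "continuous_on S g" and "\<And>t. t \<in> S \<Longrightarrow> f t \<le> g t"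
  shows "rinner x (blinfun_apply T x) \<le> rinner x (blinfun_apply U x)"
  using has_cfc_nonneg[OF has_cfc_diff[OF assms(2,1)], of x] assms
  by (auto simp: blinfun.diff_left rinner_simps intro: continuous_intros)

end

text \<open>For \<open>t\<close> outside the interval, \<open>A - t\<close> or \<open>t - A\<close>
  is coercive, with the distance to the nearer violated bound as constant, and hence
  invertible.\<close>

lemma spectral_set_interval:
  fixes A :: "'a::chilbert_space \<Rightarrow>\<^sub>L 'a"
  assumes A: "selfadjoint_op A"
    and lower: "\<And>x. a * (norm x)\<^sup>2 \<le> rinner x (blinfun_apply A x)"
    and upper: "\<And>x. rinner x (blinfun_apply A x) \<le> b * (norm x)\<^sup>2"
  shows "spectral_set A {a..b}"
proof
  show "{t. complex_of_real t \<in> spectrum_op A} \<subseteq> {a..b}"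
  proof (intro subsetI, rule ccontr)
    fix t assume t: "t \<in> {t. complex_of_real t \<in> spectrum_op A}" and "t \<notin> {a..b}"
    then consider "t < a" | "b < t"
      by force
    then have "invertible_op (A - t *\<^sub>R id_blinfun)"
    proof cases
      case 1
      show ?thesis
      proof (rule invertible_op_coercive[of _ "a - t"])
        show "(a - t) * (norm x)\<^sup>2 \<le> rinner x (blinfun_apply (A - t *\<^sub>R id_blinfun) x)" for x
          using lower[of x] by (simp add: blinfun.bilinear_simps rinner_simps rinner_self left_diff_distrib)
      qed (use 1 A in \<open>auto intro: selfadjoint_op_clinear selfadjoint_op_diff selfadjoint_op_scaleR selfadjoint_op_id\<close>)
    next
      case 2
      have "invertible_op (t *\<^sub>R id_blinfun - A)"
      proof (rule invertible_op_coercive[of _ "t - b"])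
        show "(t - b) * (norm x)\<^sup>2 \<le> rinner x (blinfun_apply (t *\<^sub>R id_blinfun - A) x)" for x
          using upper[of x] by (simp add: blinfun.bilinear_simps rinner_simps rinner_self left_diff_distrib)
      qed (use 2 A in \<open>auto intro: selfadjoint_op_clinear selfadjoint_op_diff selfadjoint_op_scaleR selfadjoint_op_id\<close>)
      then show ?thesis
        using invertible_op_scaleR[of "t *\<^sub>R id_blinfun - A" "-1"] by simp
    qed
    with t show False
      by (simp add: spectrum_op_def scalar_op_of_real)
  qed
qed (use A in auto)

subsection \<open>Scalar inequalities with Specht's ratio\<close>

lemma log_mean_one: "k \<noteq> 1 \<Longrightarrow> log_mean 1 k = (k - 1) / ln k"
  by (simp add: log_mean_def)

lemma log_mean_one_pos:
  assumes "0 < k" and "k \<noteq> 1"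
  shows "0 < log_mean 1 k"
proof (cases "1 < k")
  case False
  then have "k - 1 < 0" "ln k < 0"
    using assms by auto
  then show ?thesis
    unfolding log_mean_one[OF assms(2)] by (rule divide_neg_neg)
qed (simp add: log_mean_one[OF assms(2)])

text \<open>The power in Specht's ratio is \<open>exp (1 / L)\<close>, so the ratio equals
  \<open>L * exp (1 / L - 1)\<close>. This form is what the tangent-line bound produces.\<close>

lemma log_mean_ln_specht:
  assumes k: "0 < k" "k \<noteq> 1"
  defines "L \<equiv> log_mean 1 k"
  shows "L * ln (specht_ratio k) = 1 - L + L * ln L"
proof -
  have L: "0 < L" "1 / L = ln k / (k - 1)"
    using log_mean_one_pos[OF k] by (simp_all add: L_def log_mean_one k)
  have "k powr (1 / (k - 1)) = exp (1 / L)"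
    using k L by (simp add: powr_def)
  then have "specht_ratio k = exp (1 / L) / (exp 1 * (1 / L))"
    by (simp add: specht_ratio_def)
  also have "\<dots> = exp (1 / L - 1) * L"
    by (simp add: exp_diff)
  finally have "ln (specht_ratio k) = (1 / L - 1) + ln L"
    using L by (simp add: ln_mult)
  then have "L * ln (specht_ratio k) = L * (1 / L) - L + L * ln L"
    by (simp only: distrib_left right_diff_distrib)
  then show ?thesis
    using L(1) by simp
qed

text \<open>
  With \<open>L = log_mean 1 s\<close>, the tangent to \<open>exp\<close> at \<open>ln L\<close> bounds \<open>s powr \<mu>\<close> from below.
\<close>

lemma young_gap_le_specht:
  assumes s: "0 < s" "s \<noteq> 1"
  shows "(1 - \<mu>) + \<mu> * s - s powr \<mu> \<le> log_mean 1 s * ln (specht_ratio s)"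
proof -
  define L where "L = log_mean 1 s"
  have L: "0 < L" "L * ln s = s - 1"
    using log_mean_one_pos[OF s] s by (simp_all add: L_def log_mean_one)
  have "L * (1 + (\<mu> * ln s - ln L)) \<le> L * exp (\<mu> * ln s - ln L)"
    using L(1) exp_ge_add_one_self by (intro mult_left_mono) auto
  also have "\<dots> = s powr \<mu>"
    using s L(1) by (simp add: powr_def exp_diff)
  finally have "L + \<mu> * (L * ln s) - L * ln L \<le> s powr \<mu>"
    by (simp add: algebra_simps)
  then have "(1 - \<mu>) + \<mu> * s - s powr \<mu> \<le> 1 - L + L * ln L"
    unfolding L(2) by (simp add: algebra_simps)
  then show ?thesis
    using log_mean_ln_specht[OF s] by (simp add: L_def)
qed

text \<open>Specht's ratio is invariant under inversion, while the logarithmic mean picks up the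
  factor \<open>1 / k\<close>. It serves to compare the left endpoint of \<open>[1/k, k]\<close>
  with the right one.\<close>

lemma log_mean_ln_specht_inverse:
  assumes k: "1 < k"
  shows "log_mean 1 (1 / k) * ln (specht_ratio (1 / k)) = log_mean 1 k * ln (specht_ratio k) / k"
proof -
  define L where "L = log_mean 1 k"
  have L: "0 < L" "L * ln k = k - 1"
    using log_mean_one_pos[of k] k by (simp_all add: L_def log_mean_one)
  have inv: "log_mean 1 (1 / k) = L / k"
    using k by (simp add: L_def log_mean_one ln_div field_simps)
  have "L / k * ln (specht_ratio (1 / k)) = 1 - L / k + L / k * ln (L / k)"
    using log_mean_ln_specht[of "1 / k"] k by (simp add: inv)
  also have "\<dots> = (k - L + L * ln L - L * ln k) / k"
    using k L by (simp add: ln_div field_simps)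
  also have "\<dots> = (1 - L + L * ln L) / k"
    unfolding L(2) by (simp add: algebra_simps)
  also have "1 - L + L * ln L = L * ln (specht_ratio k)"
    using log_mean_ln_specht[of k] k by (simp add: L_def)
  finally show ?thesis
    by (simp add: inv L_def)
qed

text \<open>The derivative is \<open>\<mu> * (1 - t powr (\<mu> - 1))\<close>, and a nonpositive
  exponent keeps the power at most 1 for \<open>t \<ge> 1\<close>.\<close>

lemma young_gap_mono:
  fixes x y \<mu> :: real
  assumes "1 \<le> x" and "x \<le> y" and "0 \<le> \<mu>" and "\<mu> \<le> 1"
  shows "(1 - \<mu>) + \<mu> * x - x powr \<mu> \<le> (1 - \<mu>) + \<mu> * y - y powr \<mu>"
proof (rule DERIV_nonneg_imp_nondecreasing[OF assms(2)])
  fix t assume "x \<le> t"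
  then have t: "1 \<le> t"
    using assms by simp
  then have "t powr (\<mu> - 1) \<le> t powr 0"
    using assms by (intro powr_mono) auto
  then have "0 \<le> \<mu> * (1 - t powr (\<mu> - 1))"
    using assms t by (intro mult_nonneg_nonneg) auto
  moreover have "((\<lambda>s. (1 - \<mu>) + \<mu> * s - s powr \<mu>) has_real_derivative \<mu> * (1 - t powr (\<mu> - 1))) (at t)"
    using t by (auto intro!: derivative_eq_intros simp: algebra_simps)
  ultimately show "\<exists>D. ((\<lambda>s. (1 - \<mu>) + \<mu> * s - s powr \<mu>) has_real_derivative D) (at t) \<and> 0 \<le> D"
    by blast
qed

text \<open>On \<open>(0, 1]\<close> the same power is at least 1, so the derivative changes
  sign.\<close>

lemma young_gap_antimono:
  fixes x y \<mu> :: real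
  assumes "0 < x" and "x \<le> y" and "y \<le> 1" and "0 \<le> \<mu>" and "\<mu> \<le> 1"
  shows "(1 - \<mu>) + \<mu> * y - y powr \<mu> \<le> (1 - \<mu>) + \<mu> * x - x powr \<mu>"
proof (rule DERIV_nonpos_imp_nonincreasing[OF assms(2)])
  fix t assume "x \<le> t" "t \<le> y"
  then have t: "0 < t" "t \<le> 1"
    using assms by simp_all
  then have "t powr 0 \<le> t powr (\<mu> - 1)"
    using assms by (intro powr_mono') auto
  then have "\<mu> * (1 - t powr (\<mu> - 1)) \<le> 0"
    using assms t by (intro mult_nonneg_nonpos) auto
  moreover have "((\<lambda>s. (1 - \<mu>) + \<mu> * s - s powr \<mu>) has_real_derivative \<mu> * (1 - t powr (\<mu> - 1))) (at t)"
    using t by (auto intro!: derivative_eq_intros simp: algebra_simps)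
  ultimately show "\<exists>D. ((\<lambda>s. (1 - \<mu>) + \<mu> * s - s powr \<mu>) has_real_derivative D) (at t) \<and> D \<le> 0"
    by blast
qed

text \<open>At weight 0 the gap is 0, and the right-hand side bounds it.\<close>

lemma log_mean_ln_specht_nonneg:
  assumes "1 < k"
  shows "0 \<le> log_mean 1 k * ln (specht_ratio k)"
  using young_gap_le_specht[of k 0] assms by simp

text \<open>The gap falls up to 1 and rises afterwards, so an endpoint is the worst case; the left
  endpoint has a bound smaller by the factor \<open>1 / k\<close>.\<close>

lemma young_gap_le:
  fixes k s \<mu> :: real
  assumes k: "1 < k" and s: "1 / k \<le> s" "s \<le> k" and \<mu>: "0 \<le> \<mu>" "\<mu> \<le> 1"
  shows "(1 - \<mu>) + \<mu> * s - s powr \<mu> \<le> log_mean 1 k * ln (specht_ratio k)"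
proof (cases "1 \<le> s")
  case True
  then have "(1 - \<mu>) + \<mu> * s - s powr \<mu> \<le> (1 - \<mu>) + \<mu> * k - k powr \<mu>"
    using s \<mu> by (intro young_gap_mono) auto
  also have "\<dots> \<le> log_mean 1 k * ln (specht_ratio k)"
    using k by (intro young_gap_le_specht) auto
  finally show ?thesis .
next
  case False
  then have "(1 - \<mu>) + \<mu> * s - s powr \<mu> \<le> (1 - \<mu>) + \<mu> * (1 / k) - (1 / k) powr \<mu>"
    using s k \<mu> by (intro young_gap_antimono) auto
  also have "\<dots> \<le> log_mean 1 (1 / k) * ln (specht_ratio (1 / k))"
    using k by (intro young_gap_le_specht) auto
  also have "\<dots> = log_mean 1 k * ln (specht_ratio k) / k"
    by (rule log_mean_ln_specht_inverse[OF k])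
  also have "\<dots> \<le> log_mean 1 k * ln (specht_ratio k) / 1"
    using k log_mean_ln_specht_nonneg[OF k] by (intro divide_left_mono) auto
  finally show ?thesis
    by simp
qed

text \<open>
  In the variable \<open>s = t powr (1/2)\<close> the refined gap is the gap of weight \<open>2 * \<nu>\<close> if \<open>\<nu> \<le> 1/2\<close>,
  and \<open>s\<close> times the gap of weight \<open>2 * \<nu> - 1\<close> otherwise; the second case costs the factor \<open>sqrt h\<close>.
\<close>

lemma refined_young_gap_le:
  fixes h t \<nu> :: real
  assumes h: "1 < h" and t: "1 / h \<le> t" "t \<le> h" and \<nu>: "0 \<le> \<nu>" "\<nu> \<le> 1"
  shows "(1 - \<nu>) + \<nu> * t - t powr \<nu> - 2 * min \<nu> (1 - \<nu>) * ((1 + t) / 2 - t powr (1/2))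
    \<le> sqrt h * (log_mean 1 (sqrt h) * ln (specht_ratio (sqrt h)))"
proof -
  define k s F where "k = sqrt h" and "s = sqrt t" and "F = log_mean 1 k * ln (specht_ratio k)"
  have k: "1 < k"
    using h by (simp add: k_def)
  have t0: "0 < t"
    using h t(1) by (smt (verit) divide_pos_pos)
  have s: "0 < s" "1 / k \<le> s" "s \<le> k"
    using t t0 real_sqrt_le_mono[OF t(1)] by (simp_all add: s_def k_def real_sqrt_divide)
  have ts: "t = s * s" "t powr (1/2) = s"
    using t0 by (simp_all add: s_def powr_half_sqrt)
  have powr: "t powr \<nu> = s powr (2 * \<nu>)"
    unfolding ts(2)[symmetric] by (simp add: powr_powr)
  have F: "0 \<le> F"
    unfolding F_def by (rule log_mean_ln_specht_nonneg[OF k])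
  have "(1 - \<nu>) + \<nu> * t - t powr \<nu> - 2 * min \<nu> (1 - \<nu>) * ((1 + t) / 2 - t powr (1/2)) \<le> k * F"
  proof (cases "\<nu> \<le> 1/2")
    case True
    \<comment> \<open>The minimum is \<open>\<nu>\<close>, so the terms in \<open>t\<close> cancel
      and only \<open>s\<close> remains.\<close>
    then have "(1 - \<nu>) + \<nu> * t - t powr \<nu> - 2 * min \<nu> (1 - \<nu>) * ((1 + t) / 2 - t powr (1/2))
        = (1 - 2 * \<nu>) + 2 * \<nu> * s - s powr (2 * \<nu>)"
      unfolding powr ts(2) by (simp add: min_def field_simps)
    also have "\<dots> \<le> F"
      unfolding F_def using k s(2,3) \<nu> True by (intro young_gap_le) auto
    also have "\<dots> \<le> k * F"
      using k F by (simp add: mult_le_cancel_right1)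
    finally show ?thesis .
  next
    case False
    \<comment> \<open>The minimum is \<open>1 - \<nu>\<close>, so the constant terms cancel and
      every remaining term contains a factor \<open>s\<close>.\<close>
    have "s powr (2 * \<nu>) = s * s powr (2 * \<nu> - 1)"
      using s(1) by (simp add: powr_diff)
    with False have "(1 - \<nu>) + \<nu> * t - t powr \<nu> - 2 * min \<nu> (1 - \<nu>) * ((1 + t) / 2 - t powr (1/2))
        = s * ((1 - (2 * \<nu> - 1)) + (2 * \<nu> - 1) * s - s powr (2 * \<nu> - 1))"
      unfolding powr ts(2) unfolding ts(1) by (simp add: min_def field_simps)
    also have "\<dots> \<le> s * F"
      unfolding F_def using k s \<nu> False by (intro mult_left_mono young_gap_le) auto
    also have "\<dots> \<le> k * F"
      using s F by (intro mult_right_mono) auto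
    finally show ?thesis .
  qed
  then show ?thesis
    by (simp add: k_def F_def)
qed

text \<open>The logarithmic mean is symmetric and homogeneous, so with \<open>k = sqrt h\<close> it
  contributes \<open>sqrt m * log_mean 1 k\<close>; the rest is
  \<open>M = k\<^sup>2 * m\<close>.\<close>

lemma specht_bound_eq:
  fixes m M :: real
  assumes m: "0 < m" "m < M"
  defines "h \<equiv> M / m"
  shows "h * sqrt M * log_mean (sqrt M) (sqrt m) * ln (specht_ratio (sqrt h))
    = sqrt h * (log_mean 1 (sqrt h) * ln (specht_ratio (sqrt h))) * M"
proof -
  define k where "k = sqrt h"
  have k: "1 < k" and h: "h = k * k" and M: "sqrt M = k * sqrt m"
    using m by (simp_all add: k_def h_def real_sqrt_divide)
  have "sqrt M \<noteq> sqrt m"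
    using m by simp
  then have "log_mean (sqrt M) (sqrt m) = (sqrt m - k * sqrt m) / (ln (sqrt m) - ln (k * sqrt m))"
    by (simp only: log_mean_def M if_False)
  also have "\<dots> = sqrt m * ((k - 1) / ln k)"
    using k m by (simp add: ln_mult field_simps)
  finally have "log_mean (sqrt M) (sqrt m) = sqrt m * log_mean 1 k"
    using k by (simp add: log_mean_one)
  moreover have "M = (k * sqrt m) * (k * sqrt m)"
    unfolding M[symmetric] using m by simp
  ultimately show ?thesis
    unfolding k_def[symmetric] M by (simp add: h)
qed


subsection \<open>The operator inequality\<close>

theorem theorem4p3:
  fixes A B :: "'a::chilbert_space \<Rightarrow>\<^sub>L 'a"
    and m M h \<nu> r :: real
  assumes "positive_op A" and "invertible_op A"
    and "positive_op B" and "invertible_op B"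
    and "0 < m"
    and "A \<succeq> m *\<^sub>R id_blinfun" and "M *\<^sub>R id_blinfun \<succeq> A"
    and "B \<succeq> m *\<^sub>R id_blinfun" and "M *\<^sub>R id_blinfun \<succeq> B"
    and "h = M / m" and "h > 1"
    and "0 \<le> \<nu>" and "\<nu> \<le> 1"
    and "r = min \<nu> (1 - \<nu>)"
  shows "(h * sqrt M * log_mean (sqrt M) (sqrt m) * ln (specht_ratio (sqrt h))) *\<^sub>R id_blinfun
    \<succeq> (1 - \<nu>) *\<^sub>R A + \<nu> *\<^sub>R B - op_gmean \<nu> A B
        - (2 * r) *\<^sub>R ((1/2) *\<^sub>R (A + B) - op_gmean (1/2) A B)"
    (is "_ \<succeq> ?X")
proof -
  have m: "0 < m" "m < M"
    using assms(5,10,11) by (auto simp: field_simps)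
  have h: "1 < h"
    by fact
  have A: "selfadjoint_op A" and B: "selfadjoint_op B"
    using assms(1,3) by (simp_all add: positive_op_iff)
  have A_bounds: "m * (norm x)\<^sup>2 \<le> rinner x (blinfun_apply A x)"
      "rinner x (blinfun_apply A x) \<le> M * (norm x)\<^sup>2"
    and B_bounds: "m * (norm x)\<^sup>2 \<le> rinner x (blinfun_apply B x)"
      "rinner x (blinfun_apply B x) \<le> M * (norm x)\<^sup>2" for x
    using assms(6-9)
    by (simp_all add: op_ge_iff blinfun.scaleR_left rinner_scaleR_right rinner_self)
  interpret A: spectral_set A "{m..M}"
    using A A_bounds by (rule spectral_set_interval)
  have cont: "continuous_on {a..b} (\<lambda>t. t powr s)" if "0 < a" for a b s :: real
    using that by (intro continuous_intros) auto
  define R Q where "R = op_powr A (1/2)" and "Q = op_powr A (- 1/2)"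
  have R: "has_cfc {m..M} (\<lambda>t. t powr (1/2)) A R" and Q: "has_cfc {m..M} (\<lambda>t. t powr (- 1/2)) A Q"
    unfolding R_def Q_def op_powr_def by (intro A.has_cfc_cfc cont m)+
  have sR: "selfadjoint_op R" and sQ: "selfadjoint_op Q"
    using selfadjoint_has_cfc R Q A by blast+
  \<comment> \<open>Only agreement of \<open>f\<close> with the power at positive \<open>t\<close>
    is asked for, so the rule can produce the functions \<open>t\<close>, \<open>1\<close> and
    \<open>1 / t\<close> directly.\<close>
  have mult: "has_cfc {m..M} f A (op_powr A s o\<^sub>L op_powr A u)"
    if "\<And>t. 0 < t \<Longrightarrow> t powr (s + u) = f t" for f s u
    unfolding op_powr_def
    by (rule has_cfc_cong[OF A.cfc_mult[OF cont cont]]) (use m that in \<open>simp_all add: powr_add\<close>)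
  have RR: "R o\<^sub>L R = A"
    using A.cfc_eqI[OF mult[of "1/2" "1/2" "\<lambda>t. t"]] A.cfc_eqI[OF has_cfc_ident] by (simp add: R_def)
  have RQ: "R o\<^sub>L Q = id_blinfun"
    using A.cfc_eqI[OF mult[of "1/2" "- 1/2" "\<lambda>t. 1"]] A.cfc_eqI[OF has_cfc_const[of _ 1]]
    by (simp add: R_def Q_def)
  have QR: "Q o\<^sub>L R = id_blinfun"
    using A.cfc_eqI[OF mult[of "- 1/2" "1/2" "\<lambda>t. 1"]] A.cfc_eqI[OF has_cfc_const[of _ 1]]
    by (simp add: R_def Q_def)
  have QQ: "has_cfc {m..M} (\<lambda>t. 1 / t) A (Q o\<^sub>L Q)"
    unfolding Q_def by (rule mult) (simp add: powr_minus_divide)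
  \<comment> \<open>The squared norm is the quadratic form of \<open>Q o\<^sub>L Q\<close>, the
    calculus of \<open>1 / t\<close>, which lies between \<open>1 / M\<close> and
    \<open>1 / m\<close> on the interval.\<close>
  have norm_Q: "1 / M * (norm x)\<^sup>2 \<le> (norm (blinfun_apply Q x))\<^sup>2"
    "(norm (blinfun_apply Q x))\<^sup>2 \<le> 1 / m * (norm x)\<^sup>2" for x
  proof -
    have "continuous_on {m..M} (\<lambda>t. 1 / t)"
      using m by (intro continuous_intros) auto
    then have "rinner x (blinfun_apply ((1 / M) *\<^sub>R id_blinfun) x) \<le> rinner x (blinfun_apply (Q o\<^sub>L Q) x)"
      "rinner x (blinfun_apply (Q o\<^sub>L Q) x) \<le> rinner x (blinfun_apply ((1 / m) *\<^sub>R id_blinfun) x)"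
      using m by (intro A.has_cfc_mono[OF has_cfc_const QQ] A.has_cfc_mono[OF QQ has_cfc_const];
          auto intro!: divide_left_mono)+
    then show "1 / M * (norm x)\<^sup>2 \<le> (norm (blinfun_apply Q x))\<^sup>2"
      "(norm (blinfun_apply Q x))\<^sup>2 \<le> 1 / m * (norm x)\<^sup>2"
      by (simp_all add: blinfun.scaleR_left rinner_scaleR_right rinner_self[symmetric]
          selfadjoint_op_rinner[OF sQ, of x])
  qed
  define T where "T = Q o\<^sub>L B o\<^sub>L Q"
  have T: "selfadjoint_op T"
    unfolding T_def by (rule selfadjoint_op_sandwich[OF sQ B])
  have T_eq: "rinner x (blinfun_apply T x) = rinner (blinfun_apply Q x) (blinfun_apply B (blinfun_apply Q x))" for x
    by (simp add: T_def selfadjoint_op_rinner[OF sQ, of x])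
  have T_lower: "1 / h * (norm x)\<^sup>2 \<le> rinner x (blinfun_apply T x)" for x
  proof -
    have "1 / h * (norm x)\<^sup>2 = m * (1 / M * (norm x)\<^sup>2)"
      using m by (simp add: assms(10))
    also have "\<dots> \<le> m * (norm (blinfun_apply Q x))\<^sup>2"
      using norm_Q(1) m by (intro mult_left_mono) auto
    also have "\<dots> \<le> rinner x (blinfun_apply T x)"
      unfolding T_eq by (rule B_bounds)
    finally show ?thesis .
  qed
  have T_upper: "rinner x (blinfun_apply T x) \<le> h * (norm x)\<^sup>2" for x
  proof -
    have "rinner x (blinfun_apply T x) \<le> M * (norm (blinfun_apply Q x))\<^sup>2"
      unfolding T_eq by (rule B_bounds)
    also have "\<dots> \<le> M * (1 / m * (norm x)\<^sup>2)"
      using norm_Q(2) m by (intro mult_left_mono) auto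
    also have "\<dots> = h * (norm x)\<^sup>2"
      by (simp add: assms(10))
    finally show ?thesis .
  qed
  interpret T: spectral_set T "{1 / h..h}"
    using T T_lower T_upper by (rule spectral_set_interval)
  have G: "has_cfc {1 / h..h} (\<lambda>t. t powr s) T (op_powr T s)" for s
    unfolding op_powr_def using h by (intro T.has_cfc_cfc cont) simp
  \<comment> \<open>\<open>W\<close> is the refined Young gap evaluated at \<open>T\<close>: what
    remains of the right-hand side once \<open>R\<close> is taken out on both sides.\<close>
  define W where "W = (1 - \<nu>) *\<^sub>R id_blinfun + \<nu> *\<^sub>R T - op_powr T \<nu>
    - (2 * r) *\<^sub>R ((1/2) *\<^sub>R (id_blinfun + T) - op_powr T (1/2))"
  define c where "c = sqrt h * (log_mean 1 (sqrt h) * ln (specht_ratio (sqrt h)))"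
  let ?g = "\<lambda>t. (1 - \<nu>) + \<nu> * t - t powr \<nu> - (2 * r) * ((1/2) * (1 + t) - t powr (1/2))"
  have W: "has_cfc {1 / h..h} ?g T W"
    unfolding W_def
    using has_cfc_const[of "{1 / h..h}" 1 T]
    by (intro has_cfc_diff has_cfc_add has_cfc_scaleR has_cfc_const has_cfc_ident G) simp
  have "rinner x (blinfun_apply W x) \<le> rinner x (blinfun_apply (c *\<^sub>R id_blinfun) x)" for x
  proof (rule T.has_cfc_mono[OF W has_cfc_const])
    show "continuous_on {1 / h..h} ?g"
      using h by (intro continuous_intros cont) auto
    show "?g t \<le> c" if "t \<in> {1 / h..h}" for t
      using refined_young_gap_le[OF h, of t \<nu>] that assms(12,13) by (simp add: c_def assms(14))
  qed simp
  then have W_le: "rinner x (blinfun_apply W x) \<le> c * (norm x)\<^sup>2" for x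
    by (simp add: blinfun.scaleR_left rinner_scaleR_right rinner_self)
  \<comment> \<open>The sign of \<open>c\<close> matters when the upper bound on \<open>A\<close> is
    multiplied by it.\<close>
  have c: "0 \<le> c"
    unfolding c_def using h by (intro mult_nonneg_nonneg[of "sqrt h"] log_mean_ln_specht_nonneg) auto
  have RQ_apply: "blinfun_apply R (blinfun_apply R x) = blinfun_apply A x"
    "blinfun_apply R (blinfun_apply Q x) = x" "blinfun_apply Q (blinfun_apply R x) = x" for x
    using RR RQ QR by (metis blinfun_apply_blinfun_compose blinfun_apply_id_blinfun)+
  \<comment> \<open>Sandwiching by \<open>R\<close> turns \<open>id_blinfun\<close> into
    \<open>A\<close> and \<open>T\<close> into \<open>B\<close>, and turns powers of
    \<open>T\<close> into the geometric means by definition.\<close>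
  have X: "?X = R o\<^sub>L W o\<^sub>L R"
    unfolding op_gmean_def R_def[symmetric] Q_def[symmetric] T_def[symmetric] W_def
    by (rule blinfun_eqI) (simp add: blinfun.bilinear_simps RQ_apply T_def)
  have "rinner x (blinfun_apply ?X x) \<le> c * M * (norm x)\<^sup>2" for x
  proof -
    have "rinner x (blinfun_apply ?X x) = rinner (blinfun_apply R x) (blinfun_apply W (blinfun_apply R x))"
      by (simp add: X selfadjoint_op_rinner[OF sR, of x])
    also have "\<dots> \<le> c * (norm (blinfun_apply R x))\<^sup>2"
      by (rule W_le)
    also have "(norm (blinfun_apply R x))\<^sup>2 = rinner x (blinfun_apply A x)"
      by (simp add: rinner_self[symmetric] selfadjoint_op_rinner[OF sR, of x] flip: RQ_apply(1))
    also have "c * \<dots> \<le> c * (M * (norm x)\<^sup>2)"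
      using A_bounds(2) c by (rule mult_left_mono)
    finally show ?thesis
      by (simp add: mult.assoc)
  qed
  moreover have "selfadjoint_op ?X"
    unfolding X using sR selfadjoint_has_cfc[OF W T] by (rule selfadjoint_op_sandwich)
  ultimately have "(c * M) *\<^sub>R id_blinfun \<succeq> ?X"
    by (simp add: op_ge_iff selfadjoint_op_diff selfadjoint_op_scaleR selfadjoint_op_id
        blinfun.scaleR_left rinner_scaleR_right rinner_self)
  then show ?thesis
    using specht_bound_eq[OF m] by (simp only: assms(10) c_def)
qed

end
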